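(* Let $p=(0,0)\in\Sigma$ be a fold-fold tangential singularity of a planar Filippov vector field $Z=(F^+,F^-)_f$ with $f(x,y)=y$, write $F^\pm=(F_1^\pm,F_2^\pm)$, let $$k=\mathrm{sign}(F^-_1(0,0))\frac{1}{|F_1^+(0,0)|}\frac{\partial F_2^+}{\partial x}(0,0)-\mathrm{sign}(F^+_1(0,0))\frac{1}{|F_1^-(0,0)|}\frac{\partial F_2^-}{\partial x}(0,0),$$ and assume that $k\ne0$. Then the following statements hold: (a) If $F^+_1(0,0)F^-_1(0,0)>0$, then $I_p(Z)=0$. (b) If $F^+_1(0,0)F^-_1(0,0)<0$ and $k>0$, then $I_p(Z)=1$. (c) If $F^+_1(0,0)F^-_1(0,0)<0$ and $k<0$, then $I_p(Z)=-1$.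
   Context: "Smooth" means $C^l$ with $l\ge 1$ large enough for the derivatives used to exist. For $u,v\in\mathbb{R}^2$, $(u|v)$ is the matrix with columns $u,v$. Planar Filippov vector field (here with $f(x,y)=y$): $D\subset\mathbb{R}^2$ is an open neighborhood of the origin, $\Sigma=D\cap\{y=0\}$, $\Sigma^+=D\cap\{y\ge0\}$, $\Sigma^-=D\cap\{y\le0\}$. $F^\pm:D\to\mathbb{R}^2$ are smooth, and $Z=(F^+,F^-)_f$ equals $F^+$ on $\Sigma^+$ and $F^-$ on $\Sigma^-$ (two-valued on $\Sigma$), with Filippov's convention on $\Sigma$. Write $Ff=\langle\nabla f,F\rangle$ (so $F^\pm f=F_2^\pm$) and $F^2f=F(Ff)$. $\Sigma^s=\{\mathbf{x}\in\Sigma:F^+f<0,\ F^-f>0\}$, $\Sigma^e=\{\mathbf{x}\in\Sigma:F^+f>0,\ F^-f<0\}$, and on $\Sigma^s\cup\Sigma^e$ the sliding vector field is $Z^s=\dfrac{F^-f\,F^+-F^+f\,F^-}{F^-f-F^+f}$. Singularities: $\mathbf{x}_0\in D$ is a singularity of $Z$ if (a) $\mathbf{x}_0\in\Sigma^+$ and $F^+(\mathbf{x}_0)=0$, or $\mathbf{x}_0\in\Sigma^-$ and $F^-(\mathbf{x}_0)=0$; or (b) $\mathbf{x}_0\in\Sigma^s\cup\Sigma^e$ and $Z^s(\mathbf{x}_0)=0$; or (c) $\mathbf{x}_0\in\Sigma$ and $F^+f(\mathbf{x}_0)=0$ or $F^-f(\mathbf{x}_0)=0$. Fold-fold tangential singularity: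 a point $p\in\Sigma$ with $F^+f(p)=F^-f(p)=0$, $(F^+)^2f(p)\ne0$ and $(F^-)^2f(p)\ne0$. Index: let $B=B_r((0,0))\subset D$ be a closed ball with no singularities of $Z$ on $\partial B$. Define $$I_{\partial B}(Z)=\frac1{2\pi}\Big(J^+_{\partial B}(Z)+J^-_{\partial B}(Z)+\int_{\Gamma^+}\omega_W+\int_{\Gamma^-}\omega_W\Big),\quad \omega_W=\frac{-y\,dx+x\,dy}{x^2+y^2},$$ where $\Gamma^\pm$ is the image under $F^\pm$ of $\partial B\cap\Sigma^\pm$, traversed counterclockwise along $\partial B$; $J^\pm_{\partial B}(Z)=0$ if $\det(F^+(\pm r,0)|F^-(\pm r,0))=0$, and otherwise $$J^\pm_{\partial B}(Z)=\pm\big(\tan^{-1}H_{(F^+,F^-)}(\pm r,0)-\tan^{-1}H_{(F^-,F^+)}(\pm r,0)\big),\quad H_{(F,G)}=\frac{\|F\|^2-\langle F,G\rangle}{\det(G|F)}.$$ For $p=(0,0)$ an isolated singularity, $I_p(Z):=I_{\partial B_r(p)}(Z)$ for any $r>0$ such that $p$ is the unique singularity in $B_r(p)\subset D$. *)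

theory Defs
  imports "HOL-Analysis.Analysis"
begin

text \<open>
  A planar Filippov vector field \<open>Z = (F\<^sup>+, F\<^sup>-)\<^sub>f\<close> with switching function \<open>f(x,y) = y\<close> is
  represented by its data: the domain \<open>D\<close> and the two smooth fields \<open>Fp\<close> (for \<open>F\<^sup>+\<close>) and
  \<open>Fm\<close> (for \<open>F\<^sup>-\<close>), of which only the values on \<open>D\<close> matter.
\<close>

definition switch_fun :: "real^2 \<Rightarrow> real" where
  "switch_fun z = z $ 2"

definition Sigma0 :: "(real^2) set \<Rightarrow> (real^2) set" where
  "Sigma0 D = {z \<in> D. switch_fun z = 0}"

definition Sigma_plus :: "(real^2) set \<Rightarrow> (real^2) set" where
  "Sigma_plus D = {z \<in> D. switch_fun z \<ge> 0}"

definition Sigma_minus :: "(real^2) set \<Rightarrow> (real^2) set" where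
  "Sigma_minus D = {z \<in> D. switch_fun z \<le> 0}"

text \<open>Class \<open>C\<^sup>1\<close> is the weakest smoothness for which all derivatives below exist
  (\<open>F(Ff)\<close> involves only first derivatives of \<open>F\<close>).\<close>

definition C1_on :: "(real^2) set \<Rightarrow> (real^2 \<Rightarrow> real^2) \<Rightarrow> bool" where
  "C1_on D F \<longleftrightarrow> (\<exists>F' :: real^2 \<Rightarrow> ((real^2) \<Rightarrow>\<^sub>L (real^2)).
     (\<forall>z\<in>D. (F has_derivative blinfun_apply (F' z)) (at z)) \<and> continuous_on D F')"

definition filippov_field ::
  "(real^2) set \<Rightarrow> (real^2 \<Rightarrow> real^2) \<Rightarrow> (real^2 \<Rightarrow> real^2) \<Rightarrow> bool" where
  "filippov_field D Fp Fm \<longleftrightarrow> open D \<and> 0 \<in> D \<and> C1_on D Fp \<and> C1_on D Fm"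

text \<open>\<open>Fg = \<langle>\<nabla>g, F\<rangle>\<close>, the pairing with the gradient being the Frechet derivative applied to \<open>F\<close>.\<close>

definition lie_deriv :: "(real^2 \<Rightarrow> real^2) \<Rightarrow> (real^2 \<Rightarrow> real) \<Rightarrow> real^2 \<Rightarrow> real" where
  "lie_deriv F g z = frechet_derivative g (at z) (F z)"

lemma lie_deriv_switch_fun: "lie_deriv F switch_fun z = F z $ 2"
proof -
  have "bounded_linear switch_fun"
    unfolding switch_fun_def [abs_def] by (rule bounded_linear_vec_nth)
  then have "(switch_fun has_derivative switch_fun) (at z)"
    by (rule bounded_linear_imp_has_derivative)
  then have "frechet_derivative switch_fun (at z) = switch_fun"
    by (rule frechet_derivative_at [symmetric])
  then show ?thesis
    by (simp add: lie_deriv_def switch_fun_def)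
qed

definition Sigma_sliding ::
  "(real^2) set \<Rightarrow> (real^2 \<Rightarrow> real^2) \<Rightarrow> (real^2 \<Rightarrow> real^2) \<Rightarrow> (real^2) set" where
  "Sigma_sliding D Fp Fm =
     {z \<in> Sigma0 D. lie_deriv Fp switch_fun z < 0 \<and> lie_deriv Fm switch_fun z > 0}"

definition Sigma_escaping ::
  "(real^2) set \<Rightarrow> (real^2 \<Rightarrow> real^2) \<Rightarrow> (real^2 \<Rightarrow> real^2) \<Rightarrow> (real^2) set" where
  "Sigma_escaping D Fp Fm =
     {z \<in> Sigma0 D. lie_deriv Fp switch_fun z > 0 \<and> lie_deriv Fm switch_fun z < 0}"

definition sliding_field ::
  "(real^2 \<Rightarrow> real^2) \<Rightarrow> (real^2 \<Rightarrow> real^2) \<Rightarrow> real^2 \<Rightarrow> real^2" where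
  "sliding_field Fp Fm z =
     (1 / (lie_deriv Fm switch_fun z - lie_deriv Fp switch_fun z)) *\<^sub>R
       (lie_deriv Fm switch_fun z *\<^sub>R Fp z - lie_deriv Fp switch_fun z *\<^sub>R Fm z)"

definition filippov_singularity ::
  "(real^2) set \<Rightarrow> (real^2 \<Rightarrow> real^2) \<Rightarrow> (real^2 \<Rightarrow> real^2) \<Rightarrow> real^2 \<Rightarrow> bool" where
  "filippov_singularity D Fp Fm z \<longleftrightarrow>
     (z \<in> Sigma_plus D \<and> Fp z = 0) \<or> (z \<in> Sigma_minus D \<and> Fm z = 0) \<or>
     (z \<in> Sigma_sliding D Fp Fm \<union> Sigma_escaping D Fp Fm \<and> sliding_field Fp Fm z = 0) \<or>
     (z \<in> Sigma0 D \<and> (lie_deriv Fp switch_fun z = 0 \<or> lie_deriv Fm switch_fun z = 0))"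

definition fold_fold ::
  "(real^2) set \<Rightarrow> (real^2 \<Rightarrow> real^2) \<Rightarrow> (real^2 \<Rightarrow> real^2) \<Rightarrow> real^2 \<Rightarrow> bool" where
  "fold_fold D Fp Fm p \<longleftrightarrow>
     p \<in> Sigma0 D \<and>
     lie_deriv Fp switch_fun p = 0 \<and> lie_deriv Fm switch_fun p = 0 \<and>
     lie_deriv Fp (lie_deriv Fp switch_fun) p \<noteq> 0 \<and>
     lie_deriv Fm (lie_deriv Fm switch_fun) p \<noteq> 0"

text \<open>\<open>det (u|v)\<close>, where \<open>(u|v)\<close> has columns \<open>u\<close> and \<open>v\<close>; \<open>vector [u, v]\<close> has them as rows.\<close>

definition det_cols :: "real^2 \<Rightarrow> real^2 \<Rightarrow> real" where
  "det_cols u v = det (transpose (vector [u, v] :: real^2^2))"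

definition H_fun :: "(real^2 \<Rightarrow> real^2) \<Rightarrow> (real^2 \<Rightarrow> real^2) \<Rightarrow> real^2 \<Rightarrow> real" where
  "H_fun F G z = ((norm (F z))\<^sup>2 - F z \<bullet> G z) / det_cols (G z) (F z)"

text \<open>The two crossing terms \<open>J\<^sup>+\<close>, \<open>J\<^sup>-\<close> of the circle of radius \<open>r\<close> correspond to the signs
  \<open>s = 1\<close> and \<open>s = -1\<close>.\<close>

definition J_term :: "real \<Rightarrow> (real^2 \<Rightarrow> real^2) \<Rightarrow> (real^2 \<Rightarrow> real^2) \<Rightarrow> real \<Rightarrow> real" where
  "J_term s Fp Fm r =
     (let z = vector [s * r, 0] in
      if det_cols (Fp z) (Fm z) = 0 then 0
      else s * (arctan (H_fun Fp Fm z) - arctan (H_fun Fm Fp z)))"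

text \<open>A 1-form \<open>P dx + Q dy\<close> is represented by its coefficient field \<open>(P, Q)\<close>.\<close>

definition line_integral ::
  "(real^2 \<Rightarrow> real^2) \<Rightarrow> (real \<Rightarrow> real^2) \<Rightarrow> real \<Rightarrow> real \<Rightarrow> real" where
  "line_integral \<omega> \<gamma> a b =
     integral {a..b} (\<lambda>t. \<omega> (\<gamma> t) \<bullet> vector_derivative \<gamma> (at t within {a..b}))"

definition winding_form :: "real^2 \<Rightarrow> real^2" where
  "winding_form z = (1 / ((z $ 1)\<^sup>2 + (z $ 2)\<^sup>2)) *\<^sub>R vector [- (z $ 2), z $ 1]"

definition circle_curve :: "real \<Rightarrow> real \<Rightarrow> real^2" where
  "circle_curve r t = vector [r * cos t, r * sin t]"

definition circle_index :: "(real^2 \<Rightarrow> real^2) \<Rightarrow> (real^2 \<Rightarrow> real^2) \<Rightarrow> real \<Rightarrow> real" where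
  "circle_index Fp Fm r =
     1 / (2 * pi) *
       (J_term 1 Fp Fm r + J_term (-1) Fp Fm r
        + line_integral winding_form (\<lambda>t. Fp (circle_curve r t)) 0 pi
        + line_integral winding_form (\<lambda>t. Fm (circle_curve r t)) pi (2 * pi))"

text \<open>Radii of closed balls around the origin that may be used to compute the index there.\<close>

definition isolating_radius ::
  "(real^2) set \<Rightarrow> (real^2 \<Rightarrow> real^2) \<Rightarrow> (real^2 \<Rightarrow> real^2) \<Rightarrow> real \<Rightarrow> bool" where
  "isolating_radius D Fp Fm r \<longleftrightarrow>
     r > 0 \<and> cball 0 r \<subseteq> D \<and> {z \<in> cball 0 r. filippov_singularity D Fp Fm z} = {0}"

text \<open>``\<open>I\<^sub>p(Z)\<close> is defined and equals \<open>i\<close>'' for \<open>p\<close> the origin: it is an isolated singularity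
  (an isolating radius exists), and every isolating radius gives the value \<open>i\<close>. The first conjunct
  makes \<open>i\<close> unique.\<close>

definition has_filippov_index ::
  "(real^2) set \<Rightarrow> (real^2 \<Rightarrow> real^2) \<Rightarrow> (real^2 \<Rightarrow> real^2) \<Rightarrow> real \<Rightarrow> bool" where
  "has_filippov_index D Fp Fm i \<longleftrightarrow>
     (\<exists>r. isolating_radius D Fp Fm r) \<and>
     (\<forall>r. isolating_radius D Fp Fm r \<longrightarrow> circle_index Fp Fm r = i)"

end

theory Submission
  imports Defs
begin

text \<open>
  Write \<open>F\<^sup>+\<close> and \<open>F\<^sup>-\<close> for the two fields. The index can be read off from the values of the fields
  on the diameter \<open>-r \<le> x \<le> r\<close> of the switching line. On the half disc where \<open>F\<^sup>\<plusminus>\<close> governs the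
  motion it has no zero, so it has a continuous angle there, and its rotation along the half circle
  equals its rotation along the diameter (\<open>line_integral_winding_form\<close>). On the diameter \<open>F\<^sup>\<plusminus>\<close> is
  horizontal only at the origin, since any other tangency would be a singularity. Hence its angle
  \<open>\<theta>\<^sup>\<plusminus>(x)\<close>, measured from the direction of \<open>F\<^sup>\<plusminus>(0,0)\<close>, is a principal argument that never meets
  the cut (\<open>axis_angle\<close>). The corner terms are the oriented angles, less than \<open>pi\<close>, through which
  one turns from one field to the other at the two ends of the diameter (\<open>J_term_eq_Arg\<close>).

  Put \<open>\<delta>(x) = \<theta>\<^sup>-(x) - \<theta>\<^sup>+(x)\<close>. Adding everything up, each end of the diameter contributes the
  discrepancy between \<open>\<delta>\<close> and the principal angle from \<open>F\<^sup>+\<close> to \<open>F\<^sup>-\<close> (\<open>circle_index_eq_angles\<close>).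
  Now \<open>F\<^sup>+\<close> and \<open>F\<^sup>-\<close> cannot be antiparallel at a point of the diameter other than the origin, since
  the sliding field would vanish there (\<open>antiparallel_imp_singularity\<close>). The
  function \<open>\<delta>\<close> is continuous with \<open>\<delta>(0) = 0\<close>, and two cases arise.

  If the fields have the same direction at the origin, antiparallel means \<open>\<bar>\<delta>\<bar> = pi\<close>. So \<open>\<bar>\<delta>\<bar>\<close>
  stays below \<open>pi\<close>, \<open>\<delta>\<close> is the principal angle at both ends, and the index is \<open>0\<close>.

  If they have opposite directions, antiparallel means \<open>\<delta> = 0\<close>, and the principal angle is
  \<open>\<delta> - pi\<close> where \<open>\<delta> > 0\<close> and \<open>\<delta> + pi\<close> where \<open>\<delta> < 0\<close>. As \<open>\<delta>\<close> vanishes only at the origin, its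
  signs at the two ends are determined by its derivative at \<open>0\<close>, which is \<open>k\<close>: the angle
  \<open>\<theta>\<^sup>\<plusminus>\<close> has slope \<open>\<partial>F\<^sub>2\<^sup>\<plusminus>/\<partial>x / F\<^sub>1\<^sup>\<plusminus>\<close> at the origin. So both ends contribute \<open>pi\<close> if
  \<open>k > 0\<close> and \<open>-pi\<close> if \<open>k < 0\<close>, and the index is the sign of \<open>k\<close>.

  This argument works on every isolating ball directly, without shrinking it. That some isolating
  ball exists follows from the fold conditions, which isolate the tangency, and \<open>k \<noteq> 0\<close>: up to a nonzero factor, \<open>k\<close> is the derivative at the origin
  of \<open>det (F\<^sup>+|F\<^sup>-)\<close> along the switching line, and pseudo-equilibria are zeros of this determinant
  (\<open>isolating_radius_exists\<close>).
\<close>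

section \<open>Continuous logarithms and the winding form\<close>

definition to_complex :: "real^2 \<Rightarrow> complex" where
  "to_complex v = Complex (v $ 1) (v $ 2)"

lemma to_complex_simps [simp]:
  "Re (to_complex v) = v $ 1" "Im (to_complex v) = v $ 2"
  "to_complex v = 0 \<longleftrightarrow> v = 0" "to_complex 0 = 0"
  by (auto simp: to_complex_def complex_eq_iff vec_eq_iff forall_2)

lemma bounded_linear_to_complex: "bounded_linear to_complex"
proof -
  have "linear to_complex"
    by (rule linearI) (auto simp: complex_eq_iff)
  then show ?thesis
    using linear_conv_bounded_linear by blast
qed

lemmas continuous_on_to_complex [continuous_intros] =
  bounded_linear.continuous_on [OF bounded_linear_to_complex]

text \<open>
  The winding form is the imaginary part of the logarithmic differential \<open>dw / w\<close>.
\<close>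

lemma winding_form_inner:
  "winding_form v \<bullet> w = Im (to_complex w / to_complex v)"
  by (simp add: winding_form_def inner_vec_def sum_2 Im_divide algebra_simps diff_divide_distrib
      power2_eq_square)

text \<open>
  Locally every continuous branch of the logarithm along a curve is a shifted principal branch.
\<close>

lemma continuous_log_has_vector_derivative:
  fixes g w :: "real \<Rightarrow> complex"
  assumes "continuous_on T g" "\<And>u. u \<in> T \<Longrightarrow> exp (g u) = w u" "t \<in> T"
    and w': "(w has_vector_derivative w') (at t within T)"
  shows "(g has_vector_derivative w' / w t) (at t within T)"
proof -
  \<comment> \<open>Near \<open>t\<close> the branch \<open>g u\<close> is \<open>Ln (w u / w t) + g t\<close>, because there \<open>g\<close> stays within
    distance \<open>pi\<close> of \<open>g t\<close>; the quotient \<open>w u / w t\<close> starts at \<open>1\<close>, off the cut of \<open>Ln\<close>.\<close>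
  have wt: "w t \<noteq> 0"
    using assms(2,3) by (metis exp_not_eq_zero)
  have "(Ln has_field_derivative 1) (at ((\<lambda>u. w u / w t) t) within (\<lambda>u. w u / w t) ` T)"
    using wt by (auto intro!: derivative_eq_intros simp: complex_nonpos_Reals_iff)
  then have "((Ln \<circ> (\<lambda>u. w u / w t)) has_vector_derivative w' / w t * 1) (at t within T)"
    by (intro field_vector_diff_chain_within has_vector_derivative_divide w')
  then have der: "((\<lambda>u. Ln (w u / w t) + g t) has_vector_derivative w' / w t) (at t within T)"
    by (auto intro!: derivative_eq_intros simp: o_def)
  obtain d where d: "d > 0" "\<And>u. u \<in> T \<Longrightarrow> dist u t < d \<Longrightarrow> dist (g u) (g t) < pi"
    using assms(1,3) pi_gt_zero unfolding continuous_on_iff by meson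
  show ?thesis
  proof (rule has_vector_derivative_transform_within [OF der d(1) assms(3)])
    fix u assume u: "u \<in> T" "dist u t < d"
    have "\<bar>Im (g u - g t)\<bar> < pi"
      using d(2)[OF u] abs_Im_le_cmod[of "g u - g t"] by (simp add: dist_norm)
    then have "Ln (exp (g u - g t)) = g u - g t"
      by (intro Ln_exp) auto
    then show "Ln (w u / w t) + g t = g u"
      using assms(2)[OF u(1)] assms(2)[OF assms(3)] by (simp add: exp_diff)
  qed
qed

text \<open>
  Two branches of the logarithm differ by a multiple of \<open>2 pi \<i>\<close>, hence by a constant on a
  connected set on which both are continuous. Off the cut the principal branch is one of them.
\<close>

lemma log_eq_Ln_plus_constant:
  fixes f g :: "'a::real_normed_vector \<Rightarrow> complex"
  assumes "connected T" "continuous_on T f" "continuous_on T g"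
    and "\<And>x. x \<in> T \<Longrightarrow> exp (g x) = f x" "\<And>x. x \<in> T \<Longrightarrow> f x \<notin> \<real>\<^sub>\<le>\<^sub>0"
    and "x \<in> T" "y \<in> T"
  shows "g x - Ln (f x) = g y - Ln (f y)"
proof -
  define h where "h = (\<lambda>x. g x - Ln (f x))"
  have "f x \<noteq> 0" if "x \<in> T" for x
    using assms(5)[OF that] by auto
  then have h1: "exp (h x) = 1" if "x \<in> T" for x
    using that assms(4) by (simp add: h_def exp_diff)
  have "h constant_on T"
  proof (rule continuous_discrete_range_constant [OF assms(1)])
    show "continuous_on T h"
      unfolding h_def using assms(2,3,5) by (intro continuous_intros) auto
    show "\<exists>e>0. \<forall>y. y \<in> T \<and> h y \<noteq> h x \<longrightarrow> e \<le> norm (h y - h x)" if "x \<in> T" for x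
    proof (intro exI[of _ "2 * pi"] conjI allI impI)
      fix y assume y: "y \<in> T \<and> h y \<noteq> h x"
      then have "\<not> \<bar>Im (h y) - Im (h x)\<bar> < 2 * pi"
        using exp_complex_eqI[of "h y" "h x"] h1 that by auto
      then show "2 * pi \<le> norm (h y - h x)"
        using abs_Im_le_cmod[of "h y - h x"] by simp
    qed auto
  qed
  then show ?thesis
    using assms(6,7) unfolding constant_on_def h_def by metis
qed

text \<open>
  A nonvanishing field on a convex set has a continuous logarithm there, so the integral of the
  winding form depends only on the endpoints of the curve. It can be read off along the chord between
  them; if the field avoids one ray along the chord, this gives a difference of principal arguments
  taken relative to that ray. The sign of \<open>s\<close> chooses between the negative and the positive real
  ray.
\<close>

lemma line_integral_winding_form:
  fixes F :: "real^2 \<Rightarrow> real^2" and c :: "real \<Rightarrow> real^2"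
  assumes "a < b" and S: "convex S" "continuous_on S F" "\<And>z. z \<in> S \<Longrightarrow> F z \<noteq> 0"
    and c: "continuous_on {a..b} c" "c ` {a..b} \<subseteq> S"
    and diff: "\<And>t. t \<in> {a..b} \<Longrightarrow> (\<lambda>t. F (c t)) differentiable (at t within {a..b})"
    and "s \<noteq> 0"
    and slit: "\<And>z. z \<in> closed_segment (c a) (c b) \<Longrightarrow> s *\<^sub>R to_complex (F z) \<notin> \<real>\<^sub>\<le>\<^sub>0"
  shows "line_integral winding_form (\<lambda>t. F (c t)) a b =
    Arg (s *\<^sub>R to_complex (F (c b))) - Arg (s *\<^sub>R to_complex (F (c a)))"
proof -
  define f where "f = (\<lambda>z. s *\<^sub>R to_complex (F z))"
  have f0: "f z \<noteq> 0" if "z \<in> S" for z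
    using S(3)[OF that] \<open>s \<noteq> 0\<close> by (simp add: f_def)
  have contf: "continuous_on S f"
    unfolding f_def using S(2) by (intro continuous_intros)
  obtain g where g: "continuous_on S g" "\<And>z. z \<in> S \<Longrightarrow> f z = exp (g z)"
    using continuous_logarithm_on_contractible [OF contf convex_imp_contractible [OF S(1)] f0]
    by metis
  define v where "v = (\<lambda>t. vector_derivative (\<lambda>t. F (c t)) (at t within {a..b}))"
  have "((\<lambda>t. winding_form (F (c t)) \<bullet> v t) has_integral (Im (g (c b)) - Im (g (c a)))) {a..b}"
  proof (rule fundamental_theorem_of_calculus)
    fix t assume t: "t \<in> {a..b}"
    have "((\<lambda>t. F (c t)) has_vector_derivative v t) (at t within {a..b})"
      unfolding v_def using diff[OF t] vector_derivative_works by blast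
    then have "((\<lambda>t. f (c t)) has_vector_derivative s *\<^sub>R to_complex (v t)) (at t within {a..b})"
      unfolding f_def
      by (auto intro!: derivative_eq_intros
          bounded_linear.has_vector_derivative [OF bounded_linear_to_complex])
    then have "((\<lambda>t. g (c t)) has_vector_derivative s *\<^sub>R to_complex (v t) / f (c t))
        (at t within {a..b})"
      using t c(2)
      by (intro continuous_log_has_vector_derivative continuous_on_compose2 [OF g(1) c(1)]
          g(2) [symmetric]) auto
    then have "((\<lambda>t. Im (g (c t))) has_vector_derivative Im (s *\<^sub>R to_complex (v t) / f (c t)))
        (at t within {a..b})"
      by (rule bounded_linear.has_vector_derivative [OF bounded_linear_Im])
    moreover have "Im (s *\<^sub>R to_complex (v t) / f (c t)) = winding_form (F (c t)) \<bullet> v t"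
      using \<open>s \<noteq> 0\<close> by (simp add: f_def winding_form_inner scaleR_conv_of_real)
    ultimately show "((\<lambda>t. Im (g (c t))) has_vector_derivative winding_form (F (c t)) \<bullet> v t)
        (at t within {a..b})"
      by simp
  qed (use \<open>a < b\<close> in auto)
  then have "line_integral winding_form (\<lambda>t. F (c t)) a b = Im (g (c b)) - Im (g (c a))"
    unfolding line_integral_def v_def by (rule integral_unique)
  moreover have seg: "closed_segment (c a) (c b) \<subseteq> S"
    using c(2) \<open>a < b\<close> S(1) by (intro closed_segment_subset) auto
  have f_slit: "f z \<notin> \<real>\<^sub>\<le>\<^sub>0" if "z \<in> closed_segment (c a) (c b)" for z
    using slit [OF that] by (simp add: f_def)
  have "g (c b) - Ln (f (c b)) = g (c a) - Ln (f (c a))"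
  proof (rule log_eq_Ln_plus_constant)
    show "connected (closed_segment (c a) (c b))"
      by (rule connected_segment)
    show "continuous_on (closed_segment (c a) (c b)) f" "continuous_on (closed_segment (c a) (c b)) g"
      using continuous_on_subset [OF contf seg] continuous_on_subset [OF g(1) seg] .
    show "exp (g z) = f z" if "z \<in> closed_segment (c a) (c b)" for z
      using that seg g(2) by (metis subsetD)
  qed (use f_slit in auto)
  then have "Im (g (c b) - Ln (f (c b))) = Im (g (c a) - Ln (f (c a)))"
    by (rule arg_cong)
  then have "Im (g (c b)) - Im (g (c a)) = Im (Ln (f (c b))) - Im (Ln (f (c a)))"
    by simp
  moreover have "c a \<in> S" "c b \<in> S"
    using c(2) \<open>a < b\<close> by auto
  then have "Im (Ln (f (c a))) = Arg (f (c a))" "Im (Ln (f (c b))) = Arg (f (c b))"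
    using f0 by (simp_all add: Arg_eq_Im_Ln)
  ultimately show ?thesis
    unfolding f_def by simp
qed

section \<open>Corner terms as oriented angles\<close>

text \<open>
  In the triangle with vertices \<open>0\<close>, \<open>1\<close>, \<open>q\<close> the two arctangents are, up to the common sign of
  \<open>Im q\<close>, the complements to \<open>pi / 2\<close> of the angles at \<open>1\<close> and at \<open>q\<close>; so their sum is the angle
  at \<open>0\<close>.
\<close>

lemma arctan_sum_eq_Arg:
  fixes q :: complex
  assumes "Im q \<noteq> 0"
  shows "arctan ((1 - Re q) / Im q) + arctan (((cmod q)\<^sup>2 - Re q) / Im q) = Arg q"
proof -
  define x y where "x = Re q" and "y = Im q"
  have y: "y \<noteq> 0" and n: "(cmod q)\<^sup>2 = x\<^sup>2 + y\<^sup>2"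
    using assms by (auto simp: x_def y_def cmod_power2)
  define A B where "A = (1 - x) / y" and "B = (x\<^sup>2 + y\<^sup>2 - x) / y"
  define K where "K = ((1 - x)\<^sup>2 + y\<^sup>2) / y\<^sup>2"
  have K: "K > 0"
    using y by (simp add: K_def add_nonneg_pos)
  have arg: "Arg (Complex 1 u) = arctan u" for u
    by (subst Arg_eq_Im_Ln) (auto simp: Im_Ln_eq complex_eq_iff)
  \<comment> \<open>The two arctangents are the arguments of \<open>1 + \<i> A\<close> and \<open>1 + \<i> B\<close>, and the product of these
    numbers lies on the ray through \<open>q\<close>.\<close>
  have "Complex 1 A * Complex 1 B = of_real K * q"
    using y by (auto simp: complex_eq_iff A_def B_def K_def x_def [symmetric] y_def [symmetric]
        field_simps power2_eq_square)
  moreover have "Arg (Complex 1 A * Complex 1 B) = arctan A + arctan B"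
    using arctan_bounded[of A] arctan_bounded[of B]
    by (subst Arg_times) (auto simp: arg complex_eq_iff)
  ultimately show ?thesis
    using K by (simp add: A_def B_def n flip: x_def y_def)
qed

lemma norm_power2_2: "(norm (v :: real^2))\<^sup>2 = (v $ 1)\<^sup>2 + (v $ 2)\<^sup>2"
  by (simp add: norm_vec_def L2_set_def sum_2)

text \<open>
  The corner term is the oriented angle, less than \<open>pi\<close>, between the two field values. After
  scaling one of them to \<open>1\<close>, this is the triangle computation above.
\<close>

lemma J_term_eq_Arg:
  fixes Fp Fm :: "real^2 \<Rightarrow> real^2"
  defines "z r \<equiv> vector [r, 0]"
  assumes nz: "Fp (z (s * r)) \<noteq> 0"
    and nonpos: "to_complex (Fm (z (s * r))) / to_complex (Fp (z (s * r))) \<notin> \<real>\<^sub>\<le>\<^sub>0"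
  shows "J_term s Fp Fm r =
    - s * Arg (to_complex (Fm (z (s * r))) / to_complex (Fp (z (s * r))))"
proof -
  define u v where "u = Fp (z (s * r))" and "v = Fm (z (s * r))"
  define q where "q = to_complex v / to_complex u"
  define n where "n = (norm u)\<^sup>2"
  have u0: "u \<noteq> 0" using nz by (simp add: u_def)
  have n: "n > 0" "n = (u $ 1)\<^sup>2 + (u $ 2)\<^sup>2"
    using u0 by (simp add: n_def) (simp add: n_def norm_power2_2)
  have v: "to_complex v = q * to_complex u"
    using u0 by (simp add: q_def)
  have v12: "v $ 1 = Re q * u $ 1 - Im q * u $ 2" "v $ 2 = Re q * u $ 2 + Im q * u $ 1"
    using arg_cong [OF v, of Re] arg_cong [OF v, of Im] by simp_all
  have uv: "u \<bullet> v = n * Re q" and vv: "(norm v)\<^sup>2 = n * (cmod q)\<^sup>2"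
    unfolding n(2) norm_power2_2 cmod_power2 v12
    by (simp_all add: v12 inner_vec_def sum_2 algebra_simps power2_eq_square)
  have det: "det_cols u v = n * Im q" "det_cols v u = - (n * Im q)"
    unfolding n(2) by (simp_all add: v12 det_cols_def det_2 transpose_def algebra_simps
        power2_eq_square)
  show ?thesis
  proof (cases "Im q = 0")
    case True
    \<comment> \<open>Parallel vectors pointing in the same direction: the term is \<open>0\<close> by convention, and so is
      the angle.\<close>
    then have "Arg q = 0"
      using nonpos by (auto simp: Arg_eq_0 complex_is_Real_iff complex_nonpos_Reals_iff q_def u_def v_def)
    then show ?thesis
      using det True by (simp add: J_term_def Let_def u_def v_def q_def z_def)
  next
    case False
    have "H_fun Fp Fm (z (s * r)) = (n * (1 - Re q)) / (n * - Im q)"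
      unfolding H_fun_def u_def [symmetric] v_def [symmetric] n_def [symmetric] uv det
      by (simp add: algebra_simps)
    then have H1: "H_fun Fp Fm (z (s * r)) = - ((1 - Re q) / Im q)"
      using n(1) by simp
    have "H_fun Fm Fp (z (s * r)) = (n * ((cmod q)\<^sup>2 - Re q)) / (n * Im q)"
      unfolding H_fun_def u_def [symmetric] v_def [symmetric] inner_commute [of v u] uv vv det
      by (simp add: algebra_simps)
    then have H2: "H_fun Fm Fp (z (s * r)) = ((cmod q)\<^sup>2 - Re q) / Im q"
      using n(1) by simp
    have "J_term s Fp Fm r = s * (arctan (H_fun Fp Fm (z (s * r))) - arctan (H_fun Fm Fp (z (s * r))))"
      using det False n(1) by (simp add: J_term_def Let_def u_def v_def z_def)
    also have "\<dots> = - s * Arg q"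
      unfolding H1 H2 arctan_minus arctan_sum_eq_Arg [OF False, symmetric] by (simp add: algebra_simps)
    finally show ?thesis
      by (simp add: q_def u_def v_def)
  qed
qed

section \<open>The angle of a field along the switching line\<close>

lemma axis_point: "(vector [x, 0] :: real^2) = x *\<^sub>R axis 1 1"
  by (simp add: vec_eq_iff forall_2 axis_def)

lemma norm_axis_point [simp]: "norm (vector [x, 0] :: real^2) = \<bar>x\<bar>"
  by (simp add: norm_vec_def L2_set_def sum_2)

lemma axis_point_0 [simp]: "vector [0, 0] = (0 :: real^2)"
  by (simp add: vec_eq_iff forall_2)

lemma continuous_on_axis_point [continuous_intros]:
  "continuous_on A (\<lambda>x. vector [x, 0] :: real^2)"
  unfolding axis_point by (intro continuous_intros)

lemma has_vector_derivative_on_axis: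
  assumes "(F has_derivative F') (at (0 :: real^2))"
  shows "((\<lambda>x. F (vector [x, 0])) has_vector_derivative F' (vector [1, 0])) (at 0)"
proof -
  have "((\<lambda>x. x *\<^sub>R vector [1, 0] :: real^2) has_vector_derivative 1 *\<^sub>R vector [1, 0]) (at 0)"
    by (rule bounded_linear.has_vector_derivative [OF bounded_linear_scaleR_left])
      (auto intro!: derivative_eq_intros)
  then have "((\<lambda>x. vector [x, 0] :: real^2) has_vector_derivative vector [1, 0]) (at 0)"
    by (simp add: axis_point)
  then show ?thesis
    using vector_derivative_diff_chain_within [of "\<lambda>x. vector [x, 0]" _ 0 UNIV F F'] assms
    by (simp add: o_def has_derivative_at_withinI)
qed

lemma component_has_derivative_on_axis:
  assumes "(F has_derivative F') (at (0 :: real^2))"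
  shows "((\<lambda>x. F (vector [x, 0]) $ i) has_real_derivative F' (vector [1, 0]) $ i) (at 0)"
  using bounded_linear.has_vector_derivative
    [OF bounded_linear_vec_nth has_vector_derivative_on_axis [OF assms]]
  by (simp add: has_real_derivative_iff_has_vector_derivative)

text \<open>
  The second condition of a fold only sees the derivative along the switching line, because at a
  tangency point the field is parallel to that line.
\<close>

lemma tangency_derivatives:
  fixes F :: "real^2 \<Rightarrow> real^2"
  assumes F: "F differentiable (at 0)" and F2: "F 0 $ 2 = 0"
  defines "b \<equiv> deriv (\<lambda>x. F (vector [x, 0]) $ 2) 0"
  shows "((\<lambda>x. F (vector [x, 0]) $ 2) has_real_derivative b) (at 0)"
    and "lie_deriv F (lie_deriv F switch_fun) 0 = F 0 $ 1 * b"
proof -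
  obtain F' where F': "(F has_derivative F') (at 0)"
    using F by (auto simp: differentiable_def)
  have "((\<lambda>x. F (vector [x, 0]) $ 2) has_real_derivative F' (vector [1, 0]) $ 2) (at 0)"
    by (rule component_has_derivative_on_axis [OF F'])
  moreover from this have b: "b = F' (vector [1, 0]) $ 2"
    unfolding b_def by (rule DERIV_imp_deriv)
  ultimately show "((\<lambda>x. F (vector [x, 0]) $ 2) has_real_derivative b) (at 0)"
    by simp
  have "F 0 = F 0 $ 1 *\<^sub>R vector [1, 0]"
    using F2 by (simp add: vec_eq_iff forall_2)
  then have "F' (F 0) = F 0 $ 1 *\<^sub>R F' (vector [1, 0])"
    using linear_scale [OF has_derivative_linear [OF F']] by metis
  moreover have "((\<lambda>z. F z $ 2) has_derivative (\<lambda>h. F' h $ 2)) (at 0)"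
    by (rule bounded_linear.has_derivative [OF bounded_linear_vec_nth F'])
  then have "frechet_derivative (\<lambda>z. F z $ 2) (at 0) = (\<lambda>h. F' h $ 2)"
    by (rule frechet_derivative_at [symmetric])
  moreover have "lie_deriv F switch_fun = (\<lambda>z. F z $ 2)"
    by (simp add: fun_eq_iff lie_deriv_switch_fun)
  ultimately show "lie_deriv F (lie_deriv F switch_fun) 0 = F 0 $ 1 * b"
    by (simp add: lie_deriv_def b)
qed

definition tangent_only_at_origin :: "(real^2 \<Rightarrow> real^2) \<Rightarrow> real \<Rightarrow> bool" where
  "tangent_only_at_origin F r \<longleftrightarrow>
     F 0 $ 1 \<noteq> 0 \<and> F 0 $ 2 = 0 \<and> (\<forall>x. 0 < \<bar>x\<bar> \<and> \<bar>x\<bar> \<le> r \<longrightarrow> F (vector [x, 0]) $ 2 \<noteq> 0)"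

text \<open>
  The angle of the field at \<open>(x, 0)\<close>, measured from the horizontal direction of the field at the
  origin: this puts the cut of \<open>Arg\<close> opposite to the value at the origin.
\<close>

definition axis_angle :: "(real^2 \<Rightarrow> real^2) \<Rightarrow> real \<Rightarrow> real" where
  "axis_angle F x = Arg (sgn (F 0 $ 1) *\<^sub>R to_complex (F (vector [x, 0])))"

text \<open>
  On the diameter the field is horizontal at the origin only, and there it points in the
  direction from which the angle is measured; so the cut of \<open>Arg\<close> is never met.
\<close>

lemma axis_value_notin_slit:
  assumes "tangent_only_at_origin F r" "\<bar>x\<bar> \<le> r"
  shows "sgn (F 0 $ 1) *\<^sub>R to_complex (F (vector [x, 0])) \<notin> \<real>\<^sub>\<le>\<^sub>0"
  using assms
  by (cases "x = 0") (auto simp: tangent_only_at_origin_def complex_nonpos_Reals_iff sgn_if)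

lemma axis_value_nonzero:
  assumes "tangent_only_at_origin F r" "\<bar>x\<bar> \<le> r"
  shows "to_complex (F (vector [x, 0])) \<noteq> 0"
  using axis_value_notin_slit [OF assms] by auto

lemma axis_angle_0: "F 0 $ 2 = 0 \<Longrightarrow> axis_angle F 0 = 0"
  by (auto simp: axis_angle_def Arg_eq_0 complex_is_Real_iff sgn_if)

lemma continuous_on_axis_angle:
  assumes "tangent_only_at_origin F r" "continuous_on (cball 0 r) F"
  shows "continuous_on {-r..r} (axis_angle F)"
proof -
  have "continuous_on {-r..r} (\<lambda>x. F (vector [x, 0]))"
    by (rule continuous_on_compose2 [OF assms(2)]) (auto intro: continuous_intros)
  then show ?thesis
    unfolding axis_angle_def using axis_value_notin_slit [OF assms(1)]
    by (intro continuous_intros) auto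
qed

text \<open>
  At the origin the field is horizontal and its angle is \<open>0\<close>, so to first order the angle is the
  slope of the field vector.
\<close>

lemma axis_angle_has_derivative:
  assumes "F differentiable (at 0)" and F0: "F 0 $ 1 \<noteq> 0" "F 0 $ 2 = 0"
  shows "(axis_angle F has_real_derivative
    deriv (\<lambda>x. F (vector [x, 0]) $ 2) 0 / F 0 $ 1) (at 0)"
proof -
  define s where "s = sgn (F 0 $ 1)"
  define w where "w = (\<lambda>x. s *\<^sub>R to_complex (F (vector [x, 0])))"
  have s: "s \<noteq> 0" using F0 by (simp add: s_def sgn_if)
  obtain F' where F': "(F has_derivative F') (at 0)"
    using assms(1) by (auto simp: differentiable_def)
  note dF = has_vector_derivative_on_axis [OF F']
  define d where "d = s *\<^sub>R to_complex (F' (vector [1, 0]))"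
  have "((\<lambda>x. F (vector [x, 0]) $ 2) has_real_derivative F' (vector [1, 0]) $ 2) (at 0)"
    by (rule component_has_derivative_on_axis [OF F'])
  then have b: "deriv (\<lambda>x. F (vector [x, 0]) $ 2) 0 = F' (vector [1, 0]) $ 2"
    by (rule DERIV_imp_deriv)
  have w0: "w 0 = of_real (s * F 0 $ 1)"
    using F0 by (simp add: w_def complex_eq_iff)
  have pos: "s * F 0 $ 1 > 0"
    using F0 by (simp add: s_def sgn_if)
  then have slit: "w 0 \<notin> \<real>\<^sub>\<le>\<^sub>0"
    by (simp add: w0 complex_nonpos_Reals_iff)
  have dw: "(w has_vector_derivative d) (at 0)"
    unfolding w_def d_def
    by (auto intro!: derivative_eq_intros
        bounded_linear.has_vector_derivative [OF bounded_linear_to_complex] dF)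
  have "((Ln \<circ> w) has_vector_derivative d * (1 / w 0)) (at 0)"
    by (rule field_vector_diff_chain_within [OF dw])
      (use slit in \<open>auto intro!: derivative_eq_intros simp: divide_inverse\<close>)
  then have "((\<lambda>x. Im (Ln (w x))) has_vector_derivative Im (d * (1 / w 0))) (at 0)"
    by (intro bounded_linear.has_vector_derivative [OF bounded_linear_Im]) (simp add: o_def)
  moreover have "Im (d * (1 / w 0)) = F' (vector [1, 0]) $ 2 / F 0 $ 1"
    using s by (simp add: w0 d_def Im_divide_of_real flip: of_real_mult)
  moreover have "isCont w 0"
    using dw has_vector_derivative_continuous by blast
  then have "\<forall>\<^sub>F x in nhds 0. w x \<noteq> 0"
    using continuous_at_avoid [of 0 w 0] slit unfolding eventually_nhds_metric
    by (metis dist_commute nonpos_Reals_zero_I)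
  then have "\<forall>\<^sub>F x in nhds 0. Im (Ln (w x)) = axis_angle F x"
    by eventually_elim (simp add: axis_angle_def Arg_eq_Im_Ln w_def s_def)
  ultimately show ?thesis
    unfolding b has_real_derivative_iff_has_vector_derivative [symmetric]
    by (metis DERIV_cong_ev)
qed

section \<open>Integrals over half circles\<close>

lemma circle_curve_differentiable: "circle_curve r differentiable (at t within T)"
proof -
  have eq: "circle_curve r = (\<lambda>t. (r * cos t) *\<^sub>R vector [1, 0] + (r * sin t) *\<^sub>R vector [0, 1])"
    by (simp add: circle_curve_def fun_eq_iff vec_eq_iff forall_2)
  have "(circle_curve r has_vector_derivative
      (- (r * sin t)) *\<^sub>R vector [1, 0] + (r * cos t) *\<^sub>R vector [0, 1]) (at t within T)"
    unfolding eq
    by (intro has_vector_derivative_add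
        bounded_linear.has_vector_derivative [OF bounded_linear_scaleR_left])
      (auto intro!: derivative_eq_intros simp flip: has_real_derivative_iff_has_vector_derivative)
  then show ?thesis
    by (rule differentiableI_vector)
qed

lemma norm_circle_curve: "r \<ge> 0 \<Longrightarrow> norm (circle_curve r t) = r"
  by (simp add: circle_curve_def norm_vec_def L2_set_def sum_2 power_mult_distrib
      flip: distrib_left)

lemma closed_segment_axis:
  assumes "\<bar>x\<bar> = r" "z \<in> closed_segment (vector [x, 0]) (vector [-x, 0] :: real^2)"
  obtains y where "\<bar>y\<bar> \<le> r" "z = vector [y, 0]"
proof -
  obtain u where u: "0 \<le> u" "u \<le> 1" "z = (1 - u) *\<^sub>R vector [x, 0] + u *\<^sub>R vector [-x, 0]"
    using assms(2) by (auto simp: in_segment)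
  have "\<bar>(1 - 2 * u) * x\<bar> \<le> 1 * r"
    unfolding abs_mult assms(1) using u assms(1) by (intro mult_right_mono) auto
  moreover have "z = vector [(1 - 2 * u) * x, 0]"
    by (simp add: u vec_eq_iff forall_2 algebra_simps)
  ultimately show thesis
    using that by simp
qed

text \<open>
  The diameter of the half disc is a chord along which the field avoids the cut, so the integral
  over the half circle is the difference of the angles at the two ends of the diameter.
\<close>

lemma half_circle_line_integral:
  assumes "a < b" "\<bar>x\<bar> = r" and tan: "tangent_only_at_origin F r"
    and diff: "\<And>z. z \<in> cball 0 r \<Longrightarrow> F differentiable (at z)"
    and S: "convex S" "S \<subseteq> cball 0 r" "circle_curve r ` {a..b} \<subseteq> S"
    and nz: "\<And>z. z \<in> S \<Longrightarrow> F z \<noteq> 0"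
    and ends: "circle_curve r a = vector [x, 0]" "circle_curve r b = vector [-x, 0]"
  shows "line_integral winding_form (\<lambda>t. F (circle_curve r t)) a b =
    axis_angle F (-x) - axis_angle F x"
  unfolding axis_angle_def ends [symmetric]
proof (rule line_integral_winding_form [OF \<open>a < b\<close> S(1) _ nz _ S(3)])
  show "continuous_on S F"
    using diff S(2) by (meson differentiable_imp_continuous_within continuous_at_imp_continuous_on subsetD)
  show "continuous_on {a..b} (circle_curve r)"
    using circle_curve_differentiable differentiable_imp_continuous_on
    by (metis differentiable_on_def)
  show "(\<lambda>t. F (circle_curve r t)) differentiable (at t within {a..b})" if "t \<in> {a..b}" for t
  proof -
    have "F differentiable (at (circle_curve r t) within circle_curve r ` {a..b})"
      using diff that S(2,3) by (meson differentiable_at_withinI imageI subsetD)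
    then show ?thesis
      using differentiable_chain_within [OF circle_curve_differentiable] by (simp add: o_def)
  qed
  show "sgn (F 0 $ 1) \<noteq> 0"
    using tan by (simp add: tangent_only_at_origin_def sgn_if)
  fix z assume "z \<in> closed_segment (circle_curve r a) (circle_curve r b)"
  then obtain y where "\<bar>y\<bar> \<le> r" "z = vector [y, 0]"
    unfolding ends by (rule closed_segment_axis [OF \<open>\<bar>x\<bar> = r\<close>])
  then show "sgn (F 0 $ 1) *\<^sub>R to_complex (F z) \<notin> \<real>\<^sub>\<le>\<^sub>0"
    using axis_value_notin_slit [OF tan] by simp
qed

lemma upper_half_circle_integral:
  assumes "r > 0" "tangent_only_at_origin F r"
    and "\<And>z. z \<in> cball 0 r \<Longrightarrow> F differentiable (at z)"
    and "\<And>z. z \<in> cball 0 r \<Longrightarrow> z $ 2 \<ge> 0 \<Longrightarrow> F z \<noteq> 0"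
  shows "line_integral winding_form (\<lambda>t. F (circle_curve r t)) 0 pi =
    axis_angle F (-r) - axis_angle F r"
proof (rule half_circle_line_integral [where S = "cball 0 r \<inter> {z. z $ 2 \<ge> 0}"])
  show "convex (cball 0 r \<inter> {z :: real^2. z $ 2 \<ge> 0})"
    using convex_halfspace_ge[of 0 "axis 2 1 :: real^2"]
    by (intro convex_Int convex_cball) (simp add: inner_axis')
  show "circle_curve r ` {0..pi} \<subseteq> cball 0 r \<inter> {z. z $ 2 \<ge> 0}"
    using \<open>r > 0\<close> by (auto simp: norm_circle_curve) (simp add: circle_curve_def sin_ge_zero)
qed (use assms in \<open>auto simp: circle_curve_def\<close>)

lemma lower_half_circle_integral:
  assumes "r > 0" "tangent_only_at_origin F r"
    and "\<And>z. z \<in> cball 0 r \<Longrightarrow> F differentiable (at z)"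
    and "\<And>z. z \<in> cball 0 r \<Longrightarrow> z $ 2 \<le> 0 \<Longrightarrow> F z \<noteq> 0"
  shows "line_integral winding_form (\<lambda>t. F (circle_curve r t)) pi (2 * pi) =
    axis_angle F r - axis_angle F (-r)"
proof -
  have "line_integral winding_form (\<lambda>t. F (circle_curve r t)) pi (2 * pi) =
    axis_angle F (- (-r)) - axis_angle F (-r)"
  proof (rule half_circle_line_integral [where S = "cball 0 r \<inter> {z. z $ 2 \<le> 0}"])
    show "convex (cball 0 r \<inter> {z :: real^2. z $ 2 \<le> 0})"
      using convex_halfspace_le[of "axis 2 1 :: real^2" 0]
      by (intro convex_Int convex_cball) (simp add: inner_axis')
    show "circle_curve r ` {pi..2 * pi} \<subseteq> cball 0 r \<inter> {z. z $ 2 \<le> 0}"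
    proof safe
      fix t assume "t \<in> {pi..2 * pi}"
      then have "sin t \<le> 0"
        using sin_ge_zero [of "t - pi"] by simp
      then show "circle_curve r t $ 2 \<le> 0"
        using \<open>r > 0\<close> by (simp add: circle_curve_def mult_nonneg_nonpos)
    qed (use \<open>r > 0\<close> in \<open>simp add: norm_circle_curve\<close>)
  qed (use assms in \<open>auto simp: circle_curve_def\<close>)
  then show ?thesis by simp
qed

section \<open>Arguments of quotients\<close>

lemma rcis_quotient: "v / u = rcis (cmod v / cmod u) (Arg v - Arg u)"
  by (simp add: rcis_cmod_Arg flip: rcis_divide)

lemma rcis_add_pi: "rcis a (t + pi) = - rcis a t" "rcis a (t - pi) = - rcis a t"
  by (simp_all add: rcis_def complex_eq_iff cos_diff sin_diff)

lemma Arg_quotient_same_orientation: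
  assumes "u \<noteq> 0" "v \<noteq> 0" "s \<noteq> 0" "\<bar>Arg (s *\<^sub>R v) - Arg (s *\<^sub>R u)\<bar> < pi"
  shows "Arg (v / u) = Arg (s *\<^sub>R v) - Arg (s *\<^sub>R u)"
proof -
  have "Arg ((s *\<^sub>R v) / (s *\<^sub>R u)) = Arg (s *\<^sub>R v) - Arg (s *\<^sub>R u)"
    using assms by (subst Arg_divide') auto
  then show ?thesis
    using \<open>s \<noteq> 0\<close> by (simp add: scaleR_conv_of_real)
qed

text \<open>
  When \<open>u\<close> and \<open>v\<close> are measured from opposite directions, the difference of their angles is
  off by \<open>pi\<close> from the angle between them.
\<close>

lemma quotient_opposite_orientation:
  assumes "s \<noteq> 0"
  shows "v / u = - rcis (cmod v / cmod u) (Arg ((- s) *\<^sub>R v) - Arg (s *\<^sub>R u))"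
proof -
  have "v / u = - (((- s) *\<^sub>R v) / (s *\<^sub>R u))"
    using assms by (simp add: scaleR_conv_of_real)
  also have "((- s) *\<^sub>R v) / (s *\<^sub>R u) =
      rcis (cmod ((- s) *\<^sub>R v) / cmod (s *\<^sub>R u)) (Arg ((- s) *\<^sub>R v) - Arg (s *\<^sub>R u))"
    by (rule rcis_quotient)
  also have "cmod ((- s) *\<^sub>R v) / cmod (s *\<^sub>R u) = cmod v / cmod u"
    using assms by (simp del: scaleR_minus_left)
  finally show ?thesis .
qed

lemma Arg_quotient_opposite_orientation:
  assumes "u \<noteq> 0" "v \<noteq> 0" "s \<noteq> 0"
  defines "d \<equiv> Arg ((- s) *\<^sub>R v) - Arg (s *\<^sub>R u)"
  shows "d > 0 \<Longrightarrow> Arg (v / u) = d - pi" and "d < 0 \<Longrightarrow> Arg (v / u) = d + pi"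
proof -
  have bd: "\<bar>d\<bar> < 2 * pi"
    using Arg_bounded [of "(- s) *\<^sub>R v"] Arg_bounded [of "s *\<^sub>R u"] unfolding d_def by auto
  have eq: "v / u = - rcis (cmod v / cmod u) d"
    unfolding d_def by (rule quotient_opposite_orientation) fact
  have pos: "cmod v / cmod u > 0"
    using assms by simp
  show "Arg (v / u) = d - pi" if "d > 0"
    using bd that by (intro Arg_unique' [OF pos]) (auto simp: eq rcis_add_pi)
  show "Arg (v / u) = d + pi" if "d < 0"
    using bd that by (intro Arg_unique' [OF pos]) (auto simp: eq rcis_add_pi)
qed

section \<open>The index as a sum of angle defects\<close>

lemma filippov_field_continuous:
  assumes "filippov_field D Fp Fm"
  shows "continuous_on D Fp" "continuous_on D Fm"
  using assms unfolding filippov_field_def C1_on_def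
  by (meson continuous_at_imp_continuous_on has_derivative_continuous)+

text \<open>
  If the fields are antiparallel and transversal to the switching line, they point to opposite
  sides of it, and the convex combination of them that is tangent to the line, the sliding field,
  is \<open>0\<close>: the point is a pseudo-equilibrium.
\<close>

lemma antiparallel_imp_singularity:
  assumes z: "z \<in> Sigma0 D" and nz: "Fp z $ 2 \<noteq> 0" "Fm z $ 2 \<noteq> 0"
    and anti: "to_complex (Fm z) / to_complex (Fp z) \<in> \<real>\<^sub>\<le>\<^sub>0"
  shows "filippov_singularity D Fp Fm z"
proof -
  obtain l where l: "l \<le> 0" "to_complex (Fm z) / to_complex (Fp z) = of_real l"
    using anti by (auto simp: nonpos_Reals_def)
  have "Fp z \<noteq> 0"
    using nz by auto
  then have "to_complex (Fm z) = of_real l * to_complex (Fp z)"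
    using l(2) by (simp add: field_simps)
  from arg_cong [OF this, of Re] arg_cong [OF this, of Im]
  have Fm: "Fm z = l *\<^sub>R Fp z"
    by (simp add: vec_eq_iff forall_2)
  have "l < 0"
    using l(1) nz Fm by (cases "l = 0") auto
  then have "z \<in> Sigma_sliding D Fp Fm \<union> Sigma_escaping D Fp Fm"
    using z nz by (auto simp: Sigma_sliding_def Sigma_escaping_def lie_deriv_switch_fun Fm
        zero_less_mult_iff mult_less_0_iff)
  moreover have "sliding_field Fp Fm z = 0"
    by (simp add: sliding_field_def lie_deriv_switch_fun Fm)
  ultimately show ?thesis
    by (simp add: filippov_singularity_def)
qed

lemma isolating_radius_not_singular:
  assumes "isolating_radius D Fp Fm r" "z \<noteq> 0" "norm z \<le> r"
  shows "z \<in> D" and "\<not> filippov_singularity D Fp Fm z"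
  using assms by (auto simp: isolating_radius_def subset_iff)

lemma axis_point_regular:
  assumes "isolating_radius D Fp Fm r" "0 < \<bar>x\<bar>" "\<bar>x\<bar> \<le> r"
  shows "vector [x, 0] \<in> Sigma0 D" "\<not> filippov_singularity D Fp Fm (vector [x, 0])"
proof -
  have "norm (vector [x, 0] :: real^2) \<noteq> 0"
    using assms(2) by simp
  then have "(vector [x, 0] :: real^2) \<noteq> 0"
    by (metis norm_zero)
  then show "vector [x, 0] \<in> Sigma0 D" "\<not> filippov_singularity D Fp Fm (vector [x, 0])"
    using isolating_radius_not_singular [OF assms(1)] assms(3)
    by (auto simp: Sigma0_def switch_fun_def)
qed

lemma isolating_radius_tangent_only_at_origin:
  assumes "isolating_radius D Fp Fm r"
    and "Fp 0 $ 1 \<noteq> 0" "Fp 0 $ 2 = 0" "Fm 0 $ 1 \<noteq> 0" "Fm 0 $ 2 = 0"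
  shows "tangent_only_at_origin Fp r" "tangent_only_at_origin Fm r"
  using assms axis_point_regular [OF assms(1)]
  by (auto simp: tangent_only_at_origin_def filippov_singularity_def lie_deriv_switch_fun)

lemma isolating_radius_nonvanishing:
  assumes "isolating_radius D Fp Fm r" "Fp 0 \<noteq> 0" "Fm 0 \<noteq> 0" "z \<in> cball 0 r"
  shows "z $ 2 \<ge> 0 \<Longrightarrow> Fp z \<noteq> 0" "z $ 2 \<le> 0 \<Longrightarrow> Fm z \<noteq> 0"
  using assms isolating_radius_not_singular [OF assms(1), of z]
  by (cases "z = 0"; force simp: filippov_singularity_def Sigma_plus_def Sigma_minus_def switch_fun_def)+

text \<open>
  Its argument is the oriented angle from \<open>F\<^sup>+\<close> to \<open>F\<^sup>-\<close> at \<open>(x, 0)\<close>.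
\<close>

definition axis_ratio :: "(real^2 \<Rightarrow> real^2) \<Rightarrow> (real^2 \<Rightarrow> real^2) \<Rightarrow> real \<Rightarrow> complex" where
  "axis_ratio Fp Fm x = to_complex (Fm (vector [x, 0])) / to_complex (Fp (vector [x, 0]))"

lemma axis_ratio_notin_slit:
  assumes iso: "isolating_radius D Fp Fm r" and x: "0 < \<bar>x\<bar>" "\<bar>x\<bar> \<le> r"
  shows "axis_ratio Fp Fm x \<notin> \<real>\<^sub>\<le>\<^sub>0"
  using axis_point_regular [OF iso x] antiparallel_imp_singularity [of "vector [x, 0]" D Fp Fm]
  by (auto simp: axis_ratio_def filippov_singularity_def lie_deriv_switch_fun)

lemma continuous_on_angle_difference:
  assumes fil: "filippov_field D Fp Fm" and iso: "isolating_radius D Fp Fm r"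
    and F0: "Fp 0 $ 1 \<noteq> 0" "Fp 0 $ 2 = 0" "Fm 0 $ 1 \<noteq> 0" "Fm 0 $ 2 = 0"
  shows "continuous_on {-r..r} (\<lambda>x. axis_angle Fm x - axis_angle Fp x)"
proof -
  have D: "cball 0 r \<subseteq> D"
    using iso by (simp add: isolating_radius_def)
  note cont = filippov_field_continuous [OF fil, THEN continuous_on_subset, OF D]
  note tan = isolating_radius_tangent_only_at_origin [OF iso F0]
  show ?thesis
    by (intro continuous_on_diff continuous_on_axis_angle [OF tan(1) cont(1)]
        continuous_on_axis_angle [OF tan(2) cont(2)])
qed

text \<open>
  At each end of the diameter the index collects the amount by which the difference of the
  two separately measured angles fails to be the principal angle between the fields.
\<close>

lemma circle_index_eq_angles:
  assumes fil: "filippov_field D Fp Fm" and iso: "isolating_radius D Fp Fm r"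
    and F0: "Fp 0 $ 1 \<noteq> 0" "Fp 0 $ 2 = 0" "Fm 0 $ 1 \<noteq> 0" "Fm 0 $ 2 = 0"
  defines "\<delta> \<equiv> \<lambda>x. axis_angle Fm x - axis_angle Fp x"
  shows "2 * pi * circle_index Fp Fm r =
    (\<delta> r - Arg (axis_ratio Fp Fm r)) - (\<delta> (-r) - Arg (axis_ratio Fp Fm (-r)))"
proof -
  have r: "r > 0" and D: "cball 0 r \<subseteq> D"
    using iso by (auto simp: isolating_radius_def)
  have diff: "Fp differentiable (at z)" "Fm differentiable (at z)" if "z \<in> cball 0 r" for z
    using fil D that unfolding filippov_field_def C1_on_def differentiable_def by blast+
  have nz0: "Fp 0 \<noteq> 0" "Fm 0 \<noteq> 0"
    using F0 by auto
  note tan = isolating_radius_tangent_only_at_origin [OF iso F0]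
  note nz = isolating_radius_nonvanishing [OF iso nz0]
  have axis: "Fp (vector [x, 0]) \<noteq> 0" if "\<bar>x\<bar> = r" for x
    using tan(1) r that by (force simp: tangent_only_at_origin_def)
  have J: "J_term s Fp Fm r = - s * Arg (axis_ratio Fp Fm (s * r))" if "\<bar>s\<bar> = 1" for s
    unfolding axis_ratio_def
    using axis [of "s * r"] axis_ratio_notin_slit [OF iso, of "s * r"] r that
    by (intro J_term_eq_Arg) (auto simp: abs_mult axis_ratio_def)
  have "line_integral winding_form (\<lambda>t. Fp (circle_curve r t)) 0 pi =
      axis_angle Fp (-r) - axis_angle Fp r"
    by (rule upper_half_circle_integral [OF r tan(1) diff(1) nz(1)])
  moreover have "line_integral winding_form (\<lambda>t. Fm (circle_curve r t)) pi (2 * pi) =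
      axis_angle Fm r - axis_angle Fm (-r)"
    by (rule lower_half_circle_integral [OF r tan(2) diff(2) nz(2)])
  ultimately show ?thesis
    using J [of 1] J [of "-1"] by (simp add: circle_index_def \<delta>_def)
qed

section \<open>Fields of equal or opposite orientation at the origin\<close>

text \<open>
  The difference of the two angles is \<open>0\<close> at the origin. To reach \<open>pi\<close> in absolute value it would
  have to pass a point where the fields are antiparallel, that is, a singularity.
\<close>

lemma Arg_axis_ratio_same_orientation:
  assumes fil: "filippov_field D Fp Fm" and iso: "isolating_radius D Fp Fm r"
    and F0: "Fp 0 $ 1 \<noteq> 0" "Fp 0 $ 2 = 0" "Fm 0 $ 1 \<noteq> 0" "Fm 0 $ 2 = 0"
    and same: "sgn (Fm 0 $ 1) = sgn (Fp 0 $ 1)" and x: "\<bar>x\<bar> = r"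
  shows "Arg (axis_ratio Fp Fm x) = axis_angle Fm x - axis_angle Fp x"
proof -
  define s where "s = sgn (Fp 0 $ 1)"
  define \<delta> where "\<delta> = (\<lambda>x. axis_angle Fm x - axis_angle Fp x)"
  have r: "r > 0"
    using iso by (simp add: isolating_radius_def)
  have s: "s \<noteq> 0" using F0 by (simp add: s_def sgn_if)
  note tan = isolating_radius_tangent_only_at_origin [OF iso F0]
  have nz: "to_complex (Fp (vector [y, 0])) \<noteq> 0" "to_complex (Fm (vector [y, 0])) \<noteq> 0"
    if "\<bar>y\<bar> \<le> r" for y
    using axis_value_nonzero [OF tan(1) that] axis_value_nonzero [OF tan(2) that] .
  \<comment> \<open>Moving along \<open>u * x\<close> for \<open>u\<close> from \<open>0\<close> to \<open>1\<close> treats both signs of \<open>x\<close> at once.\<close>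
  have "continuous_on {-r..r} \<delta>"
    unfolding \<delta>_def by (rule continuous_on_angle_difference [OF fil iso F0])
  moreover have "u * x \<in> {-r..r}" if "u \<in> {0..1}" for u
  proof -
    have "\<bar>u * x\<bar> \<le> r"
      using that x r by (simp add: abs_mult mult_left_le_one_le)
    then show ?thesis by auto
  qed
  ultimately have cont: "continuous_on {0..1} (\<lambda>u. \<bar>\<delta> (u * x)\<bar>)"
    by (intro continuous_on_rabs continuous_on_compose2 [of "{-r..r}" \<delta> "{0..1}" "\<lambda>u. u * x"])
      (auto intro: continuous_intros)
  have "\<bar>\<delta> x\<bar> < pi"
  proof (rule ccontr)
    assume "\<not> \<bar>\<delta> x\<bar> < pi"
    moreover have "\<delta> 0 = 0"
      using F0 by (simp add: \<delta>_def axis_angle_0)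
    ultimately obtain u where u: "0 \<le> u" "u \<le> 1" "\<bar>\<delta> (u * x)\<bar> = pi"
      using IVT' [of "\<lambda>u. \<bar>\<delta> (u * x)\<bar>" 0 pi 1] cont by auto
    define y where "y = u * x"
    have "y \<noteq> 0"
      using u(3) \<open>\<delta> 0 = 0\<close> unfolding y_def by force
    moreover have "\<bar>y\<bar> \<le> r"
      using u(1,2) x r by (simp add: y_def abs_mult mult_left_le_one_le)
    ultimately have y: "0 < \<bar>y\<bar>" "\<bar>y\<bar> \<le> r"
      by auto
    define v w where "v = s *\<^sub>R to_complex (Fp (vector [y, 0]))"
      and "w = s *\<^sub>R to_complex (Fm (vector [y, 0]))"
    have "\<delta> y = Arg w - Arg v"
      by (simp add: \<delta>_def axis_angle_def v_def w_def s_def same)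
    then have "w / v = rcis (cmod w / cmod v) (\<delta> y)"
      using rcis_quotient [of w v] by simp
    moreover have "axis_ratio Fp Fm y = w / v"
      using s by (simp add: axis_ratio_def v_def w_def scaleR_conv_of_real)
    moreover have "\<delta> y = pi \<or> \<delta> y = - pi"
      using u(3) unfolding y_def by linarith
    then have "rcis \<rho> (\<delta> y) = of_real (- \<rho>)" for \<rho>
      by (auto simp: rcis_def complex_eq_iff)
    ultimately have "axis_ratio Fp Fm y = of_real (- (cmod w / cmod v))"
      by metis
    then have "axis_ratio Fp Fm y \<in> \<real>\<^sub>\<le>\<^sub>0"
      by (simp add: complex_nonpos_Reals_iff del: of_real_minus of_real_divide)
    then show False
      using axis_ratio_notin_slit [OF iso y] by blast
  qed
  then have "\<bar>Arg (s *\<^sub>R to_complex (Fm (vector [x, 0]))) - Arg (s *\<^sub>R to_complex (Fp (vector [x, 0])))\<bar> < pi"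
    by (simp add: \<delta>_def axis_angle_def s_def same)
  then have "Arg (axis_ratio Fp Fm x) =
      Arg (s *\<^sub>R to_complex (Fm (vector [x, 0]))) - Arg (s *\<^sub>R to_complex (Fp (vector [x, 0])))"
    unfolding axis_ratio_def using x
    by (intro Arg_quotient_same_orientation nz s) auto
  then show ?thesis
    by (simp add: axis_angle_def s_def same)
qed

text \<open>
  Both angles are measured from the same direction and differ by less than \<open>pi\<close> at the ends, so
  neither end contributes.
\<close>

lemma circle_index_same_orientation:
  assumes fil: "filippov_field D Fp Fm" and iso: "isolating_radius D Fp Fm r"
    and F0: "Fp 0 $ 1 \<noteq> 0" "Fp 0 $ 2 = 0" "Fm 0 $ 1 \<noteq> 0" "Fm 0 $ 2 = 0"
    and same: "sgn (Fm 0 $ 1) = sgn (Fp 0 $ 1)"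
  shows "circle_index Fp Fm r = 0"
proof -
  have "r > 0"
    using iso by (simp add: isolating_radius_def)
  then have "2 * pi * circle_index Fp Fm r = 0"
    using circle_index_eq_angles [OF fil iso F0]
      Arg_axis_ratio_same_orientation [OF fil iso F0 same, of r]
      Arg_axis_ratio_same_orientation [OF fil iso F0 same, of "-r"] by simp
  then show ?thesis by simp
qed

text \<open>
  The angles are measured from opposite directions, so equal angles mean antiparallel fields.
\<close>

lemma angles_differ_opposite_orientation:
  assumes iso: "isolating_radius D Fp Fm r"
    and nz: "Fp 0 $ 1 \<noteq> 0"
    and opp: "sgn (Fm 0 $ 1) = - sgn (Fp 0 $ 1)" and x: "0 < \<bar>x\<bar>" "\<bar>x\<bar> \<le> r"
  shows "axis_angle Fm x - axis_angle Fp x \<noteq> 0"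
proof
  define u v where "u = to_complex (Fp (vector [x, 0]))" and "v = to_complex (Fm (vector [x, 0]))"
  assume eq: "axis_angle Fm x - axis_angle Fp x = 0"
  have "sgn (Fp 0 $ 1) \<noteq> 0"
    using nz by (simp add: sgn_if)
  from quotient_opposite_orientation [OF this, of v u]
  have "axis_ratio Fp Fm x = - of_real (cmod v / cmod u)"
    using eq opp
    by (simp add: axis_ratio_def axis_angle_def u_def v_def rcis_def)
  also have "\<dots> \<in> \<real>\<^sub>\<le>\<^sub>0"
    by (simp add: complex_nonpos_Reals_iff flip: of_real_divide)
  finally show False
    using axis_ratio_notin_slit [OF iso x] by blast
qed

lemma Arg_axis_ratio_opposite_orientation:
  assumes iso: "isolating_radius D Fp Fm r"
    and F0: "Fp 0 $ 1 \<noteq> 0" "Fp 0 $ 2 = 0" "Fm 0 $ 1 \<noteq> 0" "Fm 0 $ 2 = 0"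
    and opp: "sgn (Fm 0 $ 1) = - sgn (Fp 0 $ 1)" and x: "0 < \<bar>x\<bar>" "\<bar>x\<bar> \<le> r"
  defines "d \<equiv> axis_angle Fm x - axis_angle Fp x"
  shows "d > 0 \<Longrightarrow> Arg (axis_ratio Fp Fm x) = d - pi" "d < 0 \<Longrightarrow> Arg (axis_ratio Fp Fm x) = d + pi"
proof -
  define u v where "u = to_complex (Fp (vector [x, 0]))" and "v = to_complex (Fm (vector [x, 0]))"
  note tan = isolating_radius_tangent_only_at_origin [OF iso F0]
  have nz: "u \<noteq> 0" "v \<noteq> 0" "sgn (Fp 0 $ 1) \<noteq> 0"
    unfolding u_def v_def
    using axis_value_nonzero [OF tan(1) x(2)] axis_value_nonzero [OF tan(2) x(2)] F0(1)
    by (simp_all add: sgn_if)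
  have d: "d = Arg ((- sgn (Fp 0 $ 1)) *\<^sub>R v) - Arg (sgn (Fp 0 $ 1) *\<^sub>R u)"
    by (simp add: d_def axis_angle_def u_def v_def opp)
  show "d > 0 \<Longrightarrow> Arg (axis_ratio Fp Fm x) = d - pi" "d < 0 \<Longrightarrow> Arg (axis_ratio Fp Fm x) = d + pi"
    using Arg_quotient_opposite_orientation [OF nz]
    unfolding axis_ratio_def d u_def [symmetric] v_def [symmetric] by blast+
qed

lemma pos_at_endpoint_of_pos_derivative:
  fixes f :: "real \<Rightarrow> real"
  assumes "r > 0" "continuous_on {0..r} f" "f 0 = 0"
    and der: "(f has_real_derivative l) (at 0)" "l > 0"
    and nz: "\<And>x. 0 < x \<Longrightarrow> x \<le> r \<Longrightarrow> f x \<noteq> 0"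
  shows "f r > 0"
proof (rule ccontr)
  assume neg: "\<not> f r > 0"
  obtain d where d: "d > 0" "\<And>h. 0 < h \<Longrightarrow> h < d \<Longrightarrow> f 0 < f (0 + h)"
    using DERIV_pos_inc_right [OF der] by blast
  define h where "h = min (d / 2) r"
  have h: "0 < h" "h < d" "h \<le> r"
    using d(1) \<open>r > 0\<close> by (auto simp: h_def)
  then have "\<exists>x. h \<le> x \<and> x \<le> r \<and> f x = 0"
    using d(2) [of h] neg assms(2,3)
    by (intro IVT2') (auto intro: continuous_on_subset)
  then show False
    using nz h by force
qed

text \<open>
  The derivative decides the sign near \<open>0\<close>, and without further zeros it persists to the ends.
\<close>

lemma signs_at_endpoints_of_pos_derivative:
  fixes f :: "real \<Rightarrow> real"
  assumes "r > 0" "continuous_on {-r..r} f" "f 0 = 0"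
    and "(f has_real_derivative l) (at 0)" "l > 0"
    and "\<And>x. 0 < \<bar>x\<bar> \<Longrightarrow> \<bar>x\<bar> \<le> r \<Longrightarrow> f x \<noteq> 0"
  shows "f r > 0" and "f (-r) < 0"
proof -
  show "f r > 0"
    by (rule pos_at_endpoint_of_pos_derivative [where l = l])
      (use assms in \<open>auto intro: continuous_on_subset\<close>)
  have "((\<lambda>x. - x) has_real_derivative - 1) (at 0)"
    by (auto intro!: derivative_eq_intros)
  then have "((\<lambda>x. - f (- x)) has_real_derivative l) (at 0)"
    using DERIV_minus [OF DERIV_chain2 [where f = f and g = uminus and x = 0]] assms(4) by fastforce
  moreover have "continuous_on {0..r} (\<lambda>x. - f (- x))"
    by (intro continuous_intros continuous_on_compose2 [OF assms(2)]) auto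
  ultimately have "- f (- r) > 0"
    by (intro pos_at_endpoint_of_pos_derivative [where f = "\<lambda>x. - f (- x)" and l = l]) (use assms in auto)
  then show "f (-r) < 0" by simp
qed

text \<open>
  The difference of the angles vanishes on the diameter only at the origin, so its signs at the
  two ends are those given by its slope \<open>l\<close> at the origin. By
  \<open>Arg_axis_ratio_opposite_orientation\<close> each end then contributes \<open>sgn l * pi\<close>.
\<close>

lemma circle_index_opposite_orientation:
  assumes fil: "filippov_field D Fp Fm" and iso: "isolating_radius D Fp Fm r"
    and F0: "Fp 0 $ 1 \<noteq> 0" "Fp 0 $ 2 = 0" "Fm 0 $ 1 \<noteq> 0" "Fm 0 $ 2 = 0"
    and opp: "sgn (Fm 0 $ 1) = - sgn (Fp 0 $ 1)"
    and l: "l = deriv (\<lambda>x. Fm (vector [x, 0]) $ 2) 0 / Fm 0 $ 1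
      - deriv (\<lambda>x. Fp (vector [x, 0]) $ 2) 0 / Fp 0 $ 1" "l \<noteq> 0"
  shows "circle_index Fp Fm r = sgn l"
proof -
  define \<delta> where "\<delta> = (\<lambda>x. axis_angle Fm x - axis_angle Fp x)"
  have r: "r > 0"
    using iso by (simp add: isolating_radius_def)
  have diff: "Fp differentiable (at 0)" "Fm differentiable (at 0)"
    using fil unfolding filippov_field_def C1_on_def differentiable_def by blast+
  have cont: "continuous_on {-r..r} \<delta>"
    unfolding \<delta>_def by (rule continuous_on_angle_difference [OF fil iso F0])
  have der: "(\<delta> has_real_derivative l) (at 0)"
    unfolding \<delta>_def l
    by (intro DERIV_diff axis_angle_has_derivative diff F0)
  have zero: "\<delta> 0 = 0"
    using F0 by (simp add: \<delta>_def axis_angle_0)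
  have nz: "\<delta> x \<noteq> 0" if "0 < \<bar>x\<bar>" "\<bar>x\<bar> \<le> r" for x
    unfolding \<delta>_def by (rule angles_differ_opposite_orientation [OF iso F0(1) opp that])
  have Arg: "Arg (axis_ratio Fp Fm x) = \<delta> x - sgn (\<delta> x) * pi" if "\<bar>x\<bar> = r" for x
    using Arg_axis_ratio_opposite_orientation [OF iso F0 opp, of x] that r nz [of x]
    by (auto simp: \<delta>_def sgn_if)
  have "sgn (\<delta> r) = sgn l \<and> sgn (\<delta> (-r)) = - sgn l"
  proof (cases "l > 0")
    case True
    then show ?thesis
      using signs_at_endpoints_of_pos_derivative [OF r cont zero der True nz] by simp
  next
    case False
    have "((\<lambda>x. - \<delta> x) has_real_derivative - l) (at 0)"
      by (rule DERIV_minus [OF der])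
    then have "- \<delta> r > 0 \<and> - \<delta> (-r) < 0"
      using signs_at_endpoints_of_pos_derivative [of r "\<lambda>x. - \<delta> x" "- l"] r cont zero nz False l(2)
      by (auto intro: continuous_intros)
    then show ?thesis
      using False l(2) by simp
  qed
  moreover have "2 * pi * circle_index Fp Fm r =
      (\<delta> r - Arg (axis_ratio Fp Fm r)) - (\<delta> (-r) - Arg (axis_ratio Fp Fm (-r)))"
    unfolding \<delta>_def by (rule circle_index_eq_angles [OF fil iso F0])
  ultimately have "2 * pi * circle_index Fp Fm r = 2 * pi * sgn l"
    using Arg [of r] Arg [of "-r"] r by simp
  then show ?thesis
    by simp
qed

section \<open>Isolation of the singularity and the index of a fold-fold point\<close>

lemma eventually_neq_0_of_nonzero_derivative:
  fixes f :: "real \<Rightarrow> real"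
  assumes "(f has_real_derivative l) (at a)" "l \<noteq> 0" "f a = 0"
  shows "\<forall>\<^sub>F x in at a. f x \<noteq> 0"
proof -
  have "((\<lambda>x. (f x - f a) / (x - a)) \<longlongrightarrow> l) (at a)"
    using assms(1) by (simp add: has_field_derivative_iff)
  then have "\<forall>\<^sub>F x in at a. (f x - f a) / (x - a) \<noteq> 0"
    using assms(2) by (rule tendsto_imp_eventually_ne)
  then show ?thesis
    by eventually_elim (use assms(3) in auto)
qed

text \<open>
  Close to the origin both fields are nonzero and, on the punctured switching line, transversal;
  the sliding field vanishes only where the two fields are linearly dependent, and the determinant
  that detects this has a simple zero at the origin.
\<close>

lemma isolating_radius_exists:
  assumes fil: "filippov_field D Fp Fm"
    and F0: "Fp 0 $ 1 \<noteq> 0" "Fp 0 $ 2 = 0" "Fm 0 $ 1 \<noteq> 0" "Fm 0 $ 2 = 0"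
    and b: "((\<lambda>x. Fp (vector [x, 0]) $ 2) has_real_derivative bp) (at 0)"
      "((\<lambda>x. Fm (vector [x, 0]) $ 2) has_real_derivative bm) (at 0)"
    and nz: "bp \<noteq> 0" "bm \<noteq> 0" "bm * Fp 0 $ 1 - bp * Fm 0 $ 1 \<noteq> 0"
  shows "\<exists>r. isolating_radius D Fp Fm r"
proof -
  \<comment> \<open>\<open>N x\<close> is the first component of the numerator of the sliding field; its derivative at \<open>0\<close>
    is the number assumed to be nonzero.\<close>
  define N where "N = (\<lambda>x. Fm (vector [x, 0]) $ 2 * Fp (vector [x, 0]) $ 1
    - Fp (vector [x, 0]) $ 2 * Fm (vector [x, 0]) $ 1)"
  have D: "open D" "0 \<in> D"
    using fil by (auto simp: filippov_field_def)
  have diff: "Fp differentiable (at 0)" "Fm differentiable (at 0)"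
    using fil unfolding filippov_field_def C1_on_def differentiable_def by blast+
  obtain Fp' Fm' where F': "(Fp has_derivative Fp') (at 0)" "(Fm has_derivative Fm') (at 0)"
    using diff by (auto simp: differentiable_def)
  have "(N has_real_derivative bm * Fp 0 $ 1 - bp * Fm 0 $ 1) (at 0)"
    unfolding N_def
    by (rule derivative_eq_intros b component_has_derivative_on_axis F' refl)+ (use F0 in simp)
  then have "\<forall>\<^sub>F x in at 0. N x \<noteq> 0"
    by (rule eventually_neq_0_of_nonzero_derivative [OF _ nz(3)]) (simp add: N_def F0)
  moreover have "\<forall>\<^sub>F x in at 0. Fp (vector [x, 0]) $ 2 \<noteq> 0" "\<forall>\<^sub>F x in at 0. Fm (vector [x, 0]) $ 2 \<noteq> 0"
    using b nz F0 by (auto intro: eventually_neq_0_of_nonzero_derivative)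
  ultimately have "\<forall>\<^sub>F x in at 0. N x \<noteq> 0 \<and> Fp (vector [x, 0]) $ 2 \<noteq> 0 \<and> Fm (vector [x, 0]) $ 2 \<noteq> 0"
    by eventually_elim blast
  then obtain e where e: "e > 0"
    "\<And>x. 0 < \<bar>x\<bar> \<Longrightarrow> \<bar>x\<bar> < e \<Longrightarrow> N x \<noteq> 0 \<and> Fp (vector [x, 0]) $ 2 \<noteq> 0 \<and> Fm (vector [x, 0]) $ 2 \<noteq> 0"
    unfolding eventually_at by (auto simp: dist_real_def)
  have F00: "Fp 0 \<noteq> 0" "Fm 0 \<noteq> 0"
    using F0 by auto
  obtain e1 where e1: "e1 > 0" "\<And>z. dist 0 z < e1 \<Longrightarrow> Fp z \<noteq> 0"
    using continuous_at_avoid [OF differentiable_imp_continuous_within [OF diff(1)] F00(1)] by blast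
  obtain e2 where e2: "e2 > 0" "\<And>z. dist 0 z < e2 \<Longrightarrow> Fm z \<noteq> 0"
    using continuous_at_avoid [OF differentiable_imp_continuous_within [OF diff(2)] F00(2)] by blast
  obtain e3 where e3: "e3 > 0" "cball 0 e3 \<subseteq> D"
    using D open_contains_cball by blast
  define r where "r = min (min e e1) (min e2 e3) / 2"
  have r: "r > 0" "r < e" "r < e1" "r < e2" "r < e3"
    using e(1) e1(1) e2(1) e3(1) by (auto simp: r_def min_def)
  have "\<not> filippov_singularity D Fp Fm z" if z: "z \<in> cball 0 r" "z \<noteq> 0" for z
  proof
    assume sing: "filippov_singularity D Fp Fm z"
    have nonvan: "Fp z \<noteq> 0" "Fm z \<noteq> 0"
      using z(1) e1(2) e2(2) r by auto
    then have z2: "z $ 2 = 0"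
      using sing by (auto simp: filippov_singularity_def Sigma_sliding_def Sigma_escaping_def
          Sigma0_def switch_fun_def)
    then have zx: "z = vector [z $ 1, 0]"
      by (simp add: vec_eq_iff forall_2)
    have "z $ 1 \<noteq> 0"
      using z(2) z2 by (auto simp: vec_eq_iff forall_2)
    moreover have "\<bar>z $ 1\<bar> < e"
      using component_le_norm_cart [of z 1] z(1) r by simp
    ultimately have *: "N (z $ 1) \<noteq> 0" "Fp z $ 2 \<noteq> 0" "Fm z $ 2 \<noteq> 0"
      using e(2) [of "z $ 1"] by (simp_all flip: zx)
    then have sl: "z \<in> Sigma_sliding D Fp Fm \<union> Sigma_escaping D Fp Fm" "sliding_field Fp Fm z = 0"
      using sing nonvan by (auto simp: filippov_singularity_def lie_deriv_switch_fun)
    have "Fm z $ 2 - Fp z $ 2 \<noteq> 0"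
      using sl(1) by (auto simp: Sigma_sliding_def Sigma_escaping_def lie_deriv_switch_fun)
    then have "Fm z $ 2 *\<^sub>R Fp z - Fp z $ 2 *\<^sub>R Fm z = 0"
      using sl(2) by (simp add: sliding_field_def lie_deriv_switch_fun)
    then have "(Fm z $ 2 *\<^sub>R Fp z - Fp z $ 2 *\<^sub>R Fm z) $ 1 = 0"
      by simp
    then have "N (z $ 1) = 0"
      by (simp add: N_def flip: zx)
    then show False
      using *(1) by contradiction
  qed
  moreover have "filippov_singularity D Fp Fm 0"
    using D F0 by (simp add: filippov_singularity_def Sigma0_def switch_fun_def lie_deriv_switch_fun)
  moreover have "cball 0 r \<subseteq> D"
    using e3(2) r(5) by (meson less_imp_le subset_cball subset_trans)
  ultimately have "isolating_radius D Fp Fm r"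
    using r(1) by (auto simp: isolating_radius_def)
  then show ?thesis ..
qed

theorem proposition11:
  fixes D :: "(real^2) set" and Fp Fm :: "real^2 \<Rightarrow> real^2" and k :: real
  assumes "filippov_field D Fp Fm"
    and "fold_fold D Fp Fm 0"
    and "k = sgn (Fm 0 $ 1) * (1 / \<bar>Fp 0 $ 1\<bar>) * deriv (\<lambda>x. Fp (vector [x, 0]) $ 2) 0
           - sgn (Fp 0 $ 1) * (1 / \<bar>Fm 0 $ 1\<bar>) * deriv (\<lambda>x. Fm (vector [x, 0]) $ 2) 0"
    and "k \<noteq> 0"
  shows "(Fp 0 $ 1 * Fm 0 $ 1 > 0 \<longrightarrow> has_filippov_index D Fp Fm 0) \<and>
         (Fp 0 $ 1 * Fm 0 $ 1 < 0 \<and> k > 0 \<longrightarrow> has_filippov_index D Fp Fm 1) \<and>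
         (Fp 0 $ 1 * Fm 0 $ 1 < 0 \<and> k < 0 \<longrightarrow> has_filippov_index D Fp Fm (-1))"
proof -
  define ap am where "ap = Fp 0 $ 1" and "am = Fm 0 $ 1"
  define bp bm where "bp = deriv (\<lambda>x. Fp (vector [x, 0]) $ 2) 0"
    and "bm = deriv (\<lambda>x. Fm (vector [x, 0]) $ 2) 0"
  have diff: "Fp differentiable (at 0)" "Fm differentiable (at 0)"
    using assms(1) unfolding filippov_field_def C1_on_def differentiable_def by blast+
  have F2: "Fp 0 $ 2 = 0" "Fm 0 $ 2 = 0"
    using assms(2) by (auto simp: fold_fold_def lie_deriv_switch_fun)
  note p = tangency_derivatives [OF diff(1) F2(1), folded bp_def]
  note m = tangency_derivatives [OF diff(2) F2(2), folded bm_def]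
  have nz: "ap \<noteq> 0" "bp \<noteq> 0" "am \<noteq> 0" "bm \<noteq> 0"
    using assms(2) p(2) m(2) by (auto simp: fold_fold_def ap_def am_def)
  have k: "k = sgn am * (1 / \<bar>ap\<bar>) * bp - sgn ap * (1 / \<bar>am\<bar>) * bm"
    using assms(3) by (simp only: ap_def am_def bp_def bm_def)
  \<comment> \<open>Cleared of denominators, \<open>k\<close> is the negated slope at the origin of the numerator of the
    sliding field, so \<open>k \<noteq> 0\<close> keeps pseudo-equilibria away from the origin.\<close>
  have "\<bar>ap\<bar> * \<bar>am\<bar> * k = am * bp - ap * bm"
    using nz by (simp add: k sgn_if field_simps)
  then have "bm * ap - bp * am \<noteq> 0"
    using nz assms(4) by (auto simp: algebra_simps)
  then have ex: "\<exists>r. isolating_radius D Fp Fm r"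
    using nz F2 p(1) m(1)
    by (intro isolating_radius_exists [OF assms(1), of bp bm]) (auto simp: ap_def am_def)
  note F0 = nz(1) [unfolded ap_def] F2(1) nz(3) [unfolded am_def] F2(2)
  \<comment> \<open>For opposite orientations \<open>k\<close> is the slope at \<open>0\<close> of the angle of \<open>F\<^sup>-\<close> minus that of \<open>F\<^sup>+\<close>.\<close>
  have index_opp: "circle_index Fp Fm r = sgn k"
    if "ap * am < 0" "isolating_radius D Fp Fm r" for r
  proof (rule circle_index_opposite_orientation [OF assms(1) that(2) F0])
    show "sgn (Fm 0 $ 1) = - sgn (Fp 0 $ 1)"
      using that(1) by (auto simp: ap_def am_def mult_less_0_iff)
    show "k = deriv (\<lambda>x. Fm (vector [x, 0]) $ 2) 0 / Fm 0 $ 1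
        - deriv (\<lambda>x. Fp (vector [x, 0]) $ 2) 0 / Fp 0 $ 1"
      unfolding ap_def [symmetric] am_def [symmetric] bp_def [symmetric] bm_def [symmetric] k
      using that(1) by (auto simp: mult_less_0_iff)
  qed fact
  have "circle_index Fp Fm r = 0" if "ap * am > 0" "isolating_radius D Fp Fm r" for r
    using that by (intro circle_index_same_orientation [OF assms(1) that(2) F0])
      (auto simp: ap_def am_def zero_less_mult_iff)
  then show ?thesis
    using ex index_opp unfolding has_filippov_index_def ap_def am_def by auto
qed

end
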